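(* There exists a closed cone $C\subset\mathbb{R}^3$ which does not contain any plane (two-dimensional vector subspace of $\mathbb{R}^3$), but whose building dimension satisfies $\mathrm{bdim}(C)>1$.
   Context: A cone in $\mathbb{R}^n$ is a set $C\subset\mathbb{R}^n$ such that $\lambda x\in C$ for every $x\in C$ and every $\lambda\ge 0$. For a set $S\subset\mathbb{R}^n$, the difference set of $S$ is $\mathrm{diff}(S):=\{x-y : x,y\in S\}$. The building dimension of a cone $C\subset\mathbb{R}^n$ is $\mathrm{bdim}(C):=\sup\{\dim_{\mathcal{H}}(S) : S\subset\mathbb{R}^n,\ \mathrm{diff}(S)\subset C\}$, where $\dim_{\mathcal{H}}$ denotes the Hausdorff dimension with respect to the Euclidean distance. *)

theory Defs
  imports "HOL-Analysis.Analysis"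
begin

(* The library's powr has 0 powr 0 = 0, and its diameter of the empty set is 0; the
   standard convention for Hausdorff measure is 0^0 = 1 for nonempty sets, and that the
   empty set contributes 0. *)
definition diam_pow :: "real \<Rightarrow> 'a::metric_space set \<Rightarrow> ennreal" where
  "diam_pow s U =
     (if U = {} then 0 else if s = 0 then 1 else ennreal (diameter U powr s))"

(* Boundedness is required explicitly, since diameter is unspecified on unbounded sets.
   Finite covers are included because the U i may be empty. *)
definition hausdorff_premeasure :: "real \<Rightarrow> real \<Rightarrow> 'a::metric_space set \<Rightarrow> ennreal" where
  "hausdorff_premeasure s \<delta> S =
     (INF U \<in> {U :: nat \<Rightarrow> 'a set.
                (\<forall>i. bounded (U i) \<and> diameter (U i) \<le> \<delta>) \<and> S \<subseteq> (\<Union>i. U i)}.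
        \<Sum>i. diam_pow s (U i))"

(* Unnormalised: the dimensional constant plays no role for the Hausdorff dimension. *)
definition hausdorff_measure :: "real \<Rightarrow> 'a::metric_space set \<Rightarrow> ennreal" where
  "hausdorff_measure s S = (SUP \<delta> \<in> {0<..}. hausdorff_premeasure s \<delta> S)"

definition hausdorff_dim :: "'a::metric_space set \<Rightarrow> ennreal" where
  "hausdorff_dim S = (INF s \<in> {s. 0 \<le> s \<and> hausdorff_measure s S = 0}. ennreal s)"

definition diff_set :: "'a::ab_group_add set \<Rightarrow> 'a set" where
  "diff_set S = {x - y | x y. x \<in> S \<and> y \<in> S}"

definition bdim :: "(real ^ 'n) set \<Rightarrow> ennreal" where
  "bdim C = (SUP S \<in> {S. diff_set S \<subseteq> C}. hausdorff_dim S)"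

end

theory Submission
  imports Defs
begin

text \<open>
  Take four similarities of ratio \<open>r = 3/10\<close> that fix the vertices of a tetrahedron. Their
  attractor consists of the sums \<open>\<Sum>k. r^k t_k\<close> with all \<open>t_k\<close> in \<open>{0, e_1, e_2, e_3}\<close> (up to
  scaling), and its dimension is \<open>ln 4 / ln (1/r) > 11/10\<close> because \<open>r > 1/4\<close>.

  In barycentric coordinates a difference of two points of this set is a vector
  \<open>w = (w_0, ..., w_3)\<close> with sum \<open>0\<close>. Let \<open>n\<close> be the first place where the two digit sequences
  differ, with digits \<open>i\<close> and \<open>j\<close>. The place \<open>n\<close> adds \<open>r^n\<close> to \<open>w_i\<close> and subtracts it from
  \<open>w_j\<close>, and the later places change each coordinate by at most \<open>r^n r/(1-r)\<close>. As \<open>r < 1/3\<close>,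
  this is less than half of \<open>r^n\<close>. So two coordinates of \<open>w\<close> strictly dominate the other two in
  absolute value, and the vectors with this property (with the ratio \<open>3/4\<close> that results
  from \<open>r = 3/10\<close>) form a closed cone: \<open>diff_set_points\<close>, \<open>closed_dominance_cone\<close>.

  This cone contains no plane \<open>P\<close> (\<open>no_plane_in_dominance_cone\<close>). The pair of dominant
  coordinates would be locally constant on \<open>P - {0}\<close>, which is connected; so some coordinate
  would be dominant at every nonzero vector of \<open>P\<close>. But each coordinate is a linear functional
  and vanishes at some nonzero vector of \<open>P\<close>.

  For the dimension (\<open>hausdorff_dim_points\<close>), it suffices to keep the points whose digit
  sequence is the base-4 expansion of a number in \<open>[0,1)\<close>; only sequences that end in
  the digit 3 forever are lost. The inverse of this parametrisation is Hoelder continuous with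
  exponent \<open>11/10\<close>, so that a cover of the set pulls back to a cover of \<open>[0,1)\<close>, whose total
  length is at least 1.
\<close>

section \<open>A cone of vectors with two dominant barycentric coordinates\<close>

definition bary :: "real ^ 3 \<Rightarrow> int \<Rightarrow> real" where
  "bary w i = (if i = 1 then w $ 1 else if i = 2 then w $ 2 else if i = 3 then w $ 3
               else - (w $ 1 + w $ 2 + w $ 3))"

text \<open>
  The factor \<open>3/4 = (3/7) / (4/7)\<close> comes from the ratio \<open>r = 3/10\<close> of the self-similar set below,
  for which \<open>r/(1-r) = 3/7\<close>. What matters for the absence of planes is that it is less than 1.
\<close>
definition top_pair :: "int \<Rightarrow> int \<Rightarrow> (real ^ 3) set" where
  "top_pair i j = {w. \<forall>a\<in>{0..3} - {i, j}.
      \<bar>bary w a\<bar> \<le> 3/4 * \<bar>bary w i\<bar> \<and> \<bar>bary w a\<bar> \<le> 3/4 * \<bar>bary w j\<bar>}"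

definition dominance_cone :: "(real ^ 3) set" where
  "dominance_cone = (\<Union>i\<in>{0..3}. \<Union>j\<in>{0..3} - {i}. top_pair i j)"

lemma int_0_to_3: "{0..3::int} = {0, 1, 2, 3}"
  by auto

lemma sum_bary: "(\<Sum>i\<in>{0..3}. bary w i) = 0"
  by (simp add: int_0_to_3 bary_def)

lemma linear_bary: "linear (\<lambda>w. bary w i)"
  by (rule linearI) (auto simp: bary_def algebra_simps)

lemma bary_scaleR: "bary (c *\<^sub>R w) i = c * bary w i"
  using linear_scale[OF linear_bary] by simp

lemma continuous_on_bary [continuous_intros]: "continuous_on S (\<lambda>w. bary w i)"
  by (rule linear_continuous_on[OF linear_conv_bounded_linear[THEN iffD1, OF linear_bary]])

lemma bary_eq_0_imp:
  assumes "\<And>i. i \<in> {0..3} \<Longrightarrow> bary w i = 0"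
  shows "w = 0"
proof -
  have "bary w 1 = 0" "bary w 2 = 0" "bary w 3 = 0"
    by (rule assms; simp)+
  then show ?thesis
    by (simp add: bary_def vec_eq_iff forall_3)
qed

lemma closed_top_pair: "closed (top_pair i j)"
proof -
  have "top_pair i j = (\<Inter>a\<in>{0..3} - {i, j}.
      {w. \<bar>bary w a\<bar> \<le> 3/4 * \<bar>bary w i\<bar>} \<inter> {w. \<bar>bary w a\<bar> \<le> 3/4 * \<bar>bary w j\<bar>})"
    by (auto simp: top_pair_def)
  also have "closed \<dots>"
    by (intro closed_INT ballI closed_Int closed_Collect_le continuous_intros)
  finally show ?thesis .
qed

lemma closed_dominance_cone: "closed dominance_cone"
  unfolding dominance_cone_def by (intro closed_UN ballI closed_top_pair) auto

lemma cone_dominance_cone: "cone dominance_cone"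
proof -
  have "c *\<^sub>R w \<in> top_pair i j" if "w \<in> top_pair i j" for c w i j
  proof -
    have "\<bar>c\<bar> * \<bar>bary w a\<bar> \<le> \<bar>c\<bar> * (3/4 * \<bar>bary w l\<bar>)"
      if "\<bar>bary w a\<bar> \<le> 3/4 * \<bar>bary w l\<bar>" for a l
      using that by (intro mult_left_mono) auto
    with that show ?thesis
      by (auto simp: top_pair_def bary_scaleR abs_mult algebra_simps)
  qed
  then show ?thesis
    unfolding cone_def dominance_cone_def by blast
qed

text \<open>
  If one of the dominant coordinates vanishes, so do the two dominated ones, and then the other
  dominant one because the coordinates sum to 0.
\<close>
lemma top_pair_nonzero:
  assumes "w \<in> top_pair i j" "i \<in> {0..3}" "j \<in> {0..3}" "i \<noteq> j" and "bary w i = 0 \<or> bary w j = 0"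
  shows "w = 0"
proof (rule bary_eq_0_imp)
  have others: "bary w a = 0" if "a \<in> {0..3} - {i, j}" for a
    using assms(1,5) that by (fastforce simp: top_pair_def)
  have "(\<Sum>a\<in>{0..3}. bary w a) = (\<Sum>a\<in>{i, j}. bary w a)"
    using others assms(2,3) by (intro sum.mono_neutral_right) auto
  then have "bary w i + bary w j = 0"
    using assms(4) by (simp add: sum_bary)
  with assms(5) have "bary w i = 0" "bary w j = 0" by auto
  with others show "bary w a = 0" if "a \<in> {0..3}" for a
    using that by blast
qed

text \<open>
  Two coordinates cannot strictly dominate each other, so that a nonzero vector determines its
  dominant pair.
\<close>
lemma top_pair_unique:
  assumes w: "w \<in> top_pair i j" "w \<in> top_pair k l" "w \<noteq> 0"
    and ij: "i \<in> {0..3}" "j \<in> {0..3}" "i \<noteq> j" and kl: "k \<in> {0..3}" "l \<in> {0..3}" "k \<noteq> l"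
  shows "i \<in> {k, l}"
proof (rule ccontr)
  assume i: "i \<notin> {k, l}"
  obtain m where m: "m \<in> {k, l}" "m \<noteq> j" "m \<noteq> i"
    using kl i by (metis insertI1 insertI2)
  have "\<bar>bary w m\<bar> \<le> 3/4 * \<bar>bary w i\<bar>"
    using w(1) m kl by (auto simp: top_pair_def)
  moreover have "\<bar>bary w i\<bar> \<le> 3/4 * \<bar>bary w m\<bar>"
    using w(2) m i ij by (auto simp: top_pair_def)
  ultimately have "bary w i = 0" by linarith
  then show False
    using top_pair_nonzero[OF w(1) ij] w(3) by blast
qed

lemma kernel_in_plane:
  fixes P :: "'a::euclidean_space set" and f :: "'a \<Rightarrow> real"
  assumes "subspace P" "dim P = 2" "linear f"
  obtains w where "w \<in> P" "w \<noteq> 0" "f w = 0"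
proof (rule ccontr)
  assume none: "\<not> thesis"
  have ker: "w = 0" if "w \<in> P" "f w = 0" for w
    using none \<open>\<And>w. w \<in> P \<Longrightarrow> w \<noteq> 0 \<Longrightarrow> f w = 0 \<Longrightarrow> thesis\<close> that by blast
  have sp: "span P = P"
    using assms(1) by (simp add: span_eq_iff)
  have "inj_on f (span P)"
    unfolding sp using linear_inj_on_iff_eq_0[OF assms(3,1)] ker by blast
  then have "dim (f ` P) = 2"
    using dim_image_eq[OF assms(3)] assms(2) by metis
  moreover have "dim (f ` P) \<le> 1"
    using dim_subset_UNIV[of "f ` P"] by simp
  ultimately show False by simp
qed

lemma no_plane_in_dominance_cone:
  assumes P: "subspace P" "dim P = 2"
  shows "\<not> P \<subseteq> dominance_cone"
proof
  assume sub: "P \<subseteq> dominance_cone"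
  have conn: "connected (P - {0})"
    using P by (intro connected_punctured_convex subspace_imp_convex)
      (simp_all add: aff_dim_subspace)
  \<comment> \<open>\<open>i\<close> is dominant on \<open>A i\<close> and dominated on \<open>B i\<close>. Away from 0 these closed sets
    partition the cone, so \<open>P - {0}\<close> lies in one of them.\<close>
  define A where "A i = (\<Union>j\<in>{0..3} - {i}. top_pair i j)" for i
  define B where "B i = (\<Union>k\<in>{0..3} - {i}. \<Union>l\<in>{0..3} - {i, k}. top_pair k l)" for i
  have sym: "top_pair i j = top_pair j i" for i j
    by (auto simp: top_pair_def)
  have A_empty: "A i \<inter> (P - {0}) = {}" if i: "i \<in> {0..3}" for i
  proof -
    have "A i \<inter> B i \<inter> (P - {0}) = {}"
      using top_pair_unique i by (fastforce simp: A_def B_def)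
    moreover have "P - {0} \<subseteq> A i \<union> B i"
    proof
      fix w assume "w \<in> P - {0}"
      then have "w \<in> dominance_cone" using sub by blast
      then obtain k l where kl: "k \<in> {0..3}" "l \<in> {0..3}" "k \<noteq> l" "w \<in> top_pair k l"
        unfolding dominance_cone_def by blast
      then show "w \<in> A i \<union> B i"
        using sym[of k l] unfolding A_def B_def by (cases "i = k"; cases "i = l") auto
    qed
    moreover have "closed (A i)" "closed (B i)"
      unfolding A_def B_def by (intro closed_UN ballI closed_top_pair; simp)+
    ultimately have "A i \<inter> (P - {0}) = {} \<or> B i \<inter> (P - {0}) = {}"
      using connected_closedD[OF conn] by blast
    moreover have "B i \<inter> (P - {0}) \<noteq> {}"
    proof -
      obtain w where w: "w \<in> P" "w \<noteq> 0" "bary w i = 0"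
        using kernel_in_plane[OF P linear_bary] .
      then have "w \<notin> A i"
        using top_pair_nonzero i by (fastforce simp: A_def)
      with \<open>P - {0} \<subseteq> A i \<union> B i\<close> w show ?thesis by blast
    qed
    ultimately show ?thesis by blast
  qed
  obtain w where "w \<in> P" "w \<noteq> 0"
    using kernel_in_plane[OF P linear_bary] .
  moreover from this sub have "w \<in> dominance_cone" by blast
  then obtain i where "i \<in> {0..3}" "w \<in> A i"
    unfolding dominance_cone_def A_def by blast
  ultimately show False using A_empty by blast
qed

section \<open>A self-similar set with differences in the cone\<close>

definition digit :: "nat \<Rightarrow> real \<Rightarrow> int" where
  "digit k x = \<lfloor>4 ^ Suc k * x\<rfloor> mod 4"

definition coord :: "real \<Rightarrow> int \<Rightarrow> real" where
  "coord x i = (\<Sum>k. (3/10) ^ k * of_bool (digit k x = i))"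

text \<open>
  The 0-th barycentric coordinate is left out; \<open>sum_coord\<close> recovers it.
\<close>
definition point :: "real \<Rightarrow> real ^ 3" where
  "point x = vector [coord x 1, coord x 2, coord x 3]"

lemma digit_range: "digit k x \<in> {0..3}"
  using pos_mod_bound[of 4 "\<lfloor>4 ^ Suc k * x\<rfloor>"] by (simp add: digit_def)

lemma summable_ratio_bounded:
  fixes a :: "nat \<Rightarrow> real"
  assumes "\<And>k. \<bar>a k\<bar> \<le> 1"
  shows "summable (\<lambda>k. (3/10) ^ k * a k)"
proof (rule summable_comparison_test')
  show "summable (\<lambda>k. (3/10::real) ^ k)" by (rule summable_geometric) simp
  show "norm ((3/10) ^ k * a k) \<le> (3/10) ^ k" for k
    using mult_left_mono[OF assms, of "(3/10)^k" k] by (simp add: abs_mult)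
qed

text \<open>The terms after the \<open>n\<close>-th one are bounded by a geometric series with ratio \<open>3/10\<close>.\<close>
lemma leading_term_bound:
  fixes a :: "nat \<Rightarrow> real"
  assumes "\<And>k. \<bar>a k\<bar> \<le> 1" and "\<And>k. k < n \<Longrightarrow> a k = 0"
  shows "\<bar>(\<Sum>k. (3/10) ^ k * a k) - (3/10) ^ n * a n\<bar> \<le> 3/7 * (3/10) ^ n"
proof -
  let ?r = "3/10 :: real"
  have geo: "(\<lambda>k. ?r ^ (k + Suc n)) sums (3/7 * ?r ^ n)"
    using sums_mult[OF geometric_sums[of ?r], of "?r ^ Suc n"]
    by (simp add: power_add algebra_simps)
  have "(\<Sum>k. ?r ^ k * a k) = (\<Sum>k. ?r ^ (k + Suc n) * a (k + Suc n)) + (\<Sum>k<Suc n. ?r ^ k * a k)"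
    by (rule suminf_split_initial_segment[OF summable_ratio_bounded[OF assms(1)]])
  also have "(\<Sum>k<Suc n. ?r ^ k * a k) = ?r ^ n * a n"
    using assms(2) by simp
  finally have eq: "(\<Sum>k. ?r ^ k * a k) - ?r ^ n * a n = (\<Sum>k. ?r ^ (k + Suc n) * a (k + Suc n))"
    by simp
  have "norm (\<Sum>k. ?r ^ (k + Suc n) * a (k + Suc n)) \<le> (\<Sum>k. ?r ^ (k + Suc n))"
  proof (rule norm_suminf_le)
    show "summable (\<lambda>k. ?r ^ (k + Suc n))" using geo by (rule sums_summable)
    show "norm (?r ^ (k + Suc n) * a (k + Suc n)) \<le> ?r ^ (k + Suc n)" for k
      using mult_left_mono[OF assms(1), of "?r ^ (k + Suc n)" "k + Suc n"]
      by (simp add: abs_mult)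
  qed
  then show ?thesis
    using eq sums_unique[OF geo] by simp
qed

lemma sum_coord: "(\<Sum>i\<in>{0..3}. coord x i) = 10/7"
proof -
  have "(\<Sum>i\<in>{0..3}. coord x i) = (\<Sum>k. \<Sum>i\<in>{0..3}. (3/10) ^ k * of_bool (digit k x = i))"
    unfolding coord_def by (intro suminf_sum[symmetric] summable_ratio_bounded) simp
  also have "\<dots> = (\<Sum>k. (3/10::real) ^ k)"
  proof (rule suminf_cong)
    fix k
    show "(\<Sum>i\<in>{0..3}. (3/10::real) ^ k * of_bool (digit k x = i)) = (3/10) ^ k"
      using digit_range[of k x] by (simp add: sum_distrib_left[symmetric] of_bool_def)
  qed
  also have "(\<Sum>k. (3/10::real) ^ k) = 10/7"
    by (subst suminf_geometric) simp_all
  finally show ?thesis .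
qed

lemma bary_point_diff:
  assumes "i \<in> {0..3}"
  shows "bary (point x - point y) i = coord x i - coord y i"
  using assms sum_coord[of x] sum_coord[of y]
  by (auto simp: int_0_to_3 bary_def point_def)

text \<open>
  The place \<open>n\<close> is found through the floors \<open>\<lfloor>4^m x\<rfloor>\<close>, which encode the first \<open>m\<close> digits all at
  once: equal floors bound the distance of \<open>x\<close> and \<open>y\<close> directly, and they agree for \<open>m = 0\<close>
  because \<open>x\<close> and \<open>y\<close> lie in \<open>[0,1)\<close>.
\<close>
lemma first_different_digit:
  assumes "x \<in> {0..<1}" "y \<in> {0..<1}" "x \<noteq> y"
  obtains n where "\<bar>x - y\<bar> \<le> (1/4) ^ n" "\<And>k. k < n \<Longrightarrow> digit k x = digit k y"
    "digit n x \<noteq> digit n y"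
proof -
  have close: "\<bar>x - y\<bar> < (1/4) ^ n" if "\<lfloor>4 ^ n * x\<rfloor> = \<lfloor>4 ^ n * y\<rfloor>" for n
  proof -
    have "\<bar>4 ^ n * x - 4 ^ n * y\<bar> < 1"
      using that by linarith
    then have "4 ^ n * \<bar>x - y\<bar> < 1"
      by (simp add: right_diff_distrib[symmetric] abs_mult)
    then show ?thesis by (simp add: field_simps)
  qed
  have "\<exists>n. \<lfloor>4 ^ n * x\<rfloor> \<noteq> \<lfloor>4 ^ n * y\<rfloor>"
  proof -
    obtain n where "(1/4) ^ n < \<bar>x - y\<bar>"
      using real_arch_pow_inv[of "\<bar>x - y\<bar>" "1/4"] assms(3) by auto
    then show ?thesis using close[of n] by force
  qed
  then obtain m where m: "\<lfloor>4 ^ m * x\<rfloor> \<noteq> \<lfloor>4 ^ m * y\<rfloor>"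
      "\<And>k. k < m \<Longrightarrow> \<lfloor>4 ^ k * x\<rfloor> = \<lfloor>4 ^ k * y\<rfloor>"
    using exists_least_iff[of "\<lambda>n. \<lfloor>4 ^ n * x\<rfloor> \<noteq> \<lfloor>4 ^ n * y\<rfloor>"] by auto
  have "m \<noteq> 0"
    using m(1) assms(1,2) by (metis atLeastLessThan_iff floor_unique mult_1 of_int_0 power_0 add_0)
  then obtain n where n: "m = Suc n" using not0_implies_Suc by blast
  show ?thesis
  proof
    show "\<bar>x - y\<bar> \<le> (1/4) ^ n"
      using close[of n] m(2)[of n] n by simp
    show "digit k x = digit k y" if "k < n" for k
      using m(2)[of "Suc k"] that n by (simp add: digit_def)
    have quot: "\<lfloor>4 ^ Suc n * z\<rfloor> div 4 = \<lfloor>4 ^ n * z\<rfloor>" for z :: real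
      using floor_divide_real_eq_div[of 4 "4 ^ Suc n * z"] by simp
    have "\<lfloor>4 ^ Suc n * x\<rfloor> div 4 = \<lfloor>4 ^ Suc n * y\<rfloor> div 4"
      unfolding quot using m(2)[of n] n by simp
    then show "digit n x \<noteq> digit n y"
      using m(1) n unfolding digit_def by (metis div_mult_mod_eq)
  qed
qed

text \<open>
  At the first different place, one point contributes to coordinate \<open>i\<close> and the other to
  coordinate \<open>j\<close>. This gives both the cone condition (by comparing the two kinds of coordinates)
  and the Hoelder estimate (by comparing the large ones with \<open>\<bar>x - y\<bar>\<close>).
\<close>
lemma coord_diff_dominance:
  assumes "x \<in> {0..<1}" "y \<in> {0..<1}" "x \<noteq> y"
  obtains n i j where "\<bar>x - y\<bar> \<le> (1/4) ^ n" "i \<in> {0..3}" "j \<in> {0..3}" "i \<noteq> j"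
    "\<And>a. a \<notin> {i, j} \<Longrightarrow> \<bar>coord x a - coord y a\<bar> \<le> 3/7 * (3/10) ^ n"
    "\<And>a. a \<in> {i, j} \<Longrightarrow> 4/7 * (3/10) ^ n \<le> \<bar>coord x a - coord y a\<bar>"
proof -
  obtain n where n: "\<bar>x - y\<bar> \<le> (1/4) ^ n" "\<And>k. k < n \<Longrightarrow> digit k x = digit k y"
    "digit n x \<noteq> digit n y"
    using first_different_digit[OF assms] by blast
  define e :: "int \<Rightarrow> nat \<Rightarrow> real"
    where "e a k = of_bool (digit k x = a) - of_bool (digit k y = a)" for a k
  have diff: "coord x a - coord y a = (\<Sum>k. (3/10) ^ k * e a k)" for a
    unfolding coord_def e_def right_diff_distrib
    by (intro suminf_diff summable_ratio_bounded) simp_all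
  have bound: "\<bar>(coord x a - coord y a) - (3/10) ^ n * e a n\<bar> \<le> 3/7 * (3/10) ^ n" for a
    unfolding diff by (rule leading_term_bound) (auto simp: e_def n(2) of_bool_def)
  show ?thesis
  proof (rule that[OF n(1) digit_range digit_range n(3)])
    fix a assume "a \<notin> {digit n x, digit n y}"
    then have "e a n = 0" by (auto simp: e_def)
    with bound[of a] show "\<bar>coord x a - coord y a\<bar> \<le> 3/7 * (3/10) ^ n" by simp
  next
    fix a assume "a \<in> {digit n x, digit n y}"
    then have "e a n = 1 \<or> e a n = -1" using n(3) by (auto simp: e_def)
    moreover have "4/7 * R \<le> \<bar>c\<bar>" if "\<bar>c - R * u\<bar> \<le> 3/7 * R" "u = 1 \<or> u = -1" for c R u :: real
    proof -
      have "R \<le> \<bar>R * u\<bar>" using that(2) by auto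
      also have "\<dots> \<le> \<bar>c\<bar> + \<bar>c - R * u\<bar>"
        using abs_triangle_ineq4[of c "c - R * u"] by simp
      finally show ?thesis using that(1) by linarith
    qed
    ultimately show "4/7 * (3/10) ^ n \<le> \<bar>coord x a - coord y a\<bar>"
      using bound[of a] by blast
  qed
qed

lemma diff_set_points: "diff_set (point ` {0..<1}) \<subseteq> dominance_cone"
proof -
  have "point x - point y \<in> dominance_cone" if xy: "x \<in> {0..<1}" "y \<in> {0..<1}" for x y
  proof (cases "x = y")
    case True
    have "0 \<in> top_pair 0 1" by (simp add: top_pair_def bary_def)
    then show ?thesis using True unfolding dominance_cone_def by force
  next
    case False
    obtain n i j where d: "i \<in> {0..3}" "j \<in> {0..3}" "i \<noteq> j"
      "\<And>a. a \<notin> {i, j} \<Longrightarrow> \<bar>coord x a - coord y a\<bar> \<le> 3/7 * (3/10) ^ n"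
      "\<And>a. a \<in> {i, j} \<Longrightarrow> 4/7 * (3/10) ^ n \<le> \<bar>coord x a - coord y a\<bar>"
      using coord_diff_dominance[OF xy False] by metis
    have "u \<le> 3/4 * v" if "u \<le> 3/7 * R" "4/7 * R \<le> v" for u v R :: real
      using that by linarith
    then have "\<bar>coord x a - coord y a\<bar> \<le> 3/4 * \<bar>coord x l - coord y l\<bar>"
      if "a \<notin> {i, j}" "l \<in> {i, j}" for a l
      using d(4)[OF that(1)] d(5)[OF that(2)] by blast
    then have "point x - point y \<in> top_pair i j"
      using d(1,2) by (simp add: top_pair_def bary_point_diff)
    then show ?thesis using d(1-3) unfolding dominance_cone_def by blast
  qed
  then show ?thesis by (auto simp: diff_set_def)
qed

section \<open>The dimension of the set\<close>

text \<open>
  The numerical heart of the dimension bound: \<open>(1/4)^10 \<le> (3/10)^11\<close>, that is,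
  \<open>ln 4 / ln (10/3) \<ge> 11/10\<close>.
\<close>
lemma ratio_powr: "(1/4) ^ n \<le> ((3/10) ^ n) powr (11/10 :: real)"
proof -
  have "(1/4::real) ^ 10 \<le> ((3/10) powr (11/10)) ^ 10"
  proof -
    have "((3/10::real) powr (11/10)) ^ 10 = (3/10) powr 11"
      by (subst powr_power) simp_all
    also have "\<dots> = (3/10) ^ 11"
      by (subst powr_numeral) simp_all
    finally show ?thesis by (simp add: power_divide)
  qed
  then have "(1/4::real) \<le> (3/10) powr (11/10)"
    by (subst (asm) power_mono_iff) simp_all
  then have "(1/4::real) ^ n \<le> ((3/10) powr (11/10)) ^ n"
    by (rule power_mono) simp
  also have "\<dots> = ((3/10) powr real n) powr (11/10)"
    by (subst powr_power) (simp_all add: powr_powr)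
  also have "(3/10::real) powr real n = (3/10) ^ n"
    by (rule powr_realpow) simp
  finally show ?thesis .
qed

lemma dist_le_powr_dist_point:
  assumes "x \<in> {0..<1}" "y \<in> {0..<1}"
  shows "\<bar>x - y\<bar> \<le> (7/4) powr (11/10) * dist (point x) (point y) powr (11/10)"
proof (cases "x = y")
  case False
  obtain n i j where d: "\<bar>x - y\<bar> \<le> (1/4) ^ n" "i \<in> {0..3}" "j \<in> {0..3}" "i \<noteq> j"
    "\<And>a. a \<in> {i, j} \<Longrightarrow> 4/7 * (3/10) ^ n \<le> \<bar>coord x a - coord y a\<bar>"
    using coord_diff_dominance[OF assms False] by metis
  \<comment> \<open>One of the two large coordinates is an actual coordinate of \<open>real ^ 3\<close>.\<close>
  obtain l where l: "l \<in> {i, j}" "l \<in> {1, 2, 3}"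
    using d(2-4) by (auto simp: int_0_to_3)
  have "4/7 * (3/10) ^ n \<le> \<bar>bary (point x - point y) l\<bar>"
    using d(5)[OF l(1)] l(2) by (subst bary_point_diff) auto
  also have "\<dots> \<le> norm (point x - point y)"
    using l(2) component_le_norm_cart[of "point x - point y"]
    by (auto simp: bary_def simp del: vector_minus_component)
  finally have "(3/10) ^ n \<le> 7/4 * dist (point x) (point y)"
    by (simp add: dist_norm)
  then have "((3/10) ^ n) powr (11/10) \<le> (7/4 * dist (point x) (point y)) powr (11/10)"
    by (intro powr_mono2) auto
  also have "\<dots> = (7/4) powr (11/10) * dist (point x) (point y) powr (11/10)"
    by (rule powr_mult)
  finally show ?thesis
    using order_trans[OF d(1) ratio_powr[of n]] by (rule order_trans[rotated])
qed simp

text \<open>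
  A form of the mass distribution principle without a measure on the image: the Hoelder bound
  confines the preimage of each set of a cover to an interval of length at most
  \<open>2 M (diameter U)^s\<close>, and these intervals have total length at least 1. It suffices to use
  covers by sets of diameter at most 1, for which smaller exponents only increase the sum; this
  is how all \<open>s' \<le> s\<close> are treated together.
\<close>
lemma hausdorff_measure_image_pos:
  fixes f :: "real \<Rightarrow> 'a::metric_space"
  assumes holder: "\<And>x y. x \<in> {0..<1} \<Longrightarrow> y \<in> {0..<1} \<Longrightarrow> \<bar>x - y\<bar> \<le> M * dist (f x) (f y) powr s"
    and M: "0 < M" and s': "0 \<le> s'" "s' \<le> s" "0 < s"
  shows "0 < hausdorff_measure s' (f ` {0..<1})"
proof -
  have "ennreal (1 / (2 * M)) \<le> (\<Sum>i. diam_pow s' (U i))"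
    if U: "\<And>i. bounded (U i)" "\<And>i. diameter (U i) \<le> 1" "f ` {0..<1} \<subseteq> (\<Union>i. U i)"
    for U :: "nat \<Rightarrow> 'a set"
  proof -
    define V where "V i = {x \<in> {0..<1}. f x \<in> U i}" for i
    define h where "h i = M * diameter (U i) powr s" for i
    have "\<exists>z. V i \<subseteq> {z - h i..z + h i}" for i
    proof (cases "V i = {}")
      case False
      then obtain z where z: "z \<in> V i" by blast
      have "\<bar>z - x\<bar> \<le> h i" if "x \<in> V i" for x
      proof -
        have "\<bar>z - x\<bar> \<le> M * dist (f z) (f x) powr s"
          using z that by (intro holder) (auto simp: V_def)
        also have "\<dots> \<le> h i"
          unfolding h_def using z that M s'(3) U(1)
          by (intro mult_left_mono powr_mono2 diameter_bounded_bound) (auto simp: V_def)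
        finally show ?thesis .
      qed
      then have "V i \<subseteq> {z - h i..z + h i}" by (force simp: abs_le_iff)
      then show ?thesis ..
    qed simp
    then obtain z where z: "\<And>i. V i \<subseteq> {z i - h i..z i + h i}" by metis
    have h0: "0 \<le> h i" for i using M by (simp add: h_def)
    have "{0..<1} \<subseteq> (\<Union>i. {z i - h i..z i + h i})"
    proof
      fix x :: real assume x: "x \<in> {0..<1}"
      then obtain i where "f x \<in> U i" using U(3) by blast
      with x have "x \<in> V i" by (simp add: V_def)
      with z show "x \<in> (\<Union>i. {z i - h i..z i + h i})" by blast
    qed
    then have "emeasure lborel {0..<1::real} \<le> emeasure lborel (\<Union>i. {z i - h i..z i + h i})"
      by (intro emeasure_mono) auto
    also have "\<dots> \<le> (\<Sum>i. emeasure lborel {z i - h i..z i + h i})"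
      by (intro emeasure_subadditive_countably) auto
    also have "\<dots> = (\<Sum>i. ennreal (2 * h i))"
      using h0 by (intro suminf_cong) simp
    also have "\<dots> \<le> (\<Sum>i. ennreal (2 * M) * diam_pow s' (U i))"
    proof (intro suminf_le)
      fix i
      have d0: "0 \<le> diameter (U i)" using U(1) by (rule diameter_ge_0)
      have "ennreal (diameter (U i) powr s) \<le> diam_pow s' (U i)"
      proof (cases "U i = {}")
        case True
        then show ?thesis by (simp add: diam_pow_def)
      next
        case False
        have "diameter (U i) powr s \<le> diameter (U i) powr s'" if "s' \<noteq> 0"
          using powr_mono'[OF s'(2) d0 U(2)[of i]] .
        moreover have "diameter (U i) powr s \<le> 1"
          using d0 U(2)[of i] s'(3) by (intro powr_le1) auto
        ultimately show ?thesis using False by (auto simp: diam_pow_def intro: ennreal_leI)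
      qed
      then have "ennreal (2 * M) * ennreal (diameter (U i) powr s)
          \<le> ennreal (2 * M) * diam_pow s' (U i)"
        by (rule mult_left_mono) simp
      then show "ennreal (2 * h i) \<le> ennreal (2 * M) * diam_pow s' (U i)"
        using M by (simp add: h_def ennreal_mult[symmetric] mult.assoc)
    qed auto
    also have "\<dots> = ennreal (2 * M) * (\<Sum>i. diam_pow s' (U i))"
      by simp
    finally have "1 \<le> ennreal (2 * M) * (\<Sum>i. diam_pow s' (U i))" by simp
    then have "ennreal (1 / (2 * M)) * 1
        \<le> ennreal (1 / (2 * M)) * (ennreal (2 * M) * (\<Sum>i. diam_pow s' (U i)))"
      by (rule mult_left_mono) simp
    also have "\<dots> = (\<Sum>i. diam_pow s' (U i))"
      using M by (simp add: mult.assoc[symmetric] ennreal_mult[symmetric])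
    finally show ?thesis by simp
  qed
  then have "ennreal (1 / (2 * M)) \<le> hausdorff_premeasure s' 1 (f ` {0..<1})"
    unfolding hausdorff_premeasure_def by (intro INF_greatest) auto
  also have "\<dots> \<le> hausdorff_measure s' (f ` {0..<1})"
    unfolding hausdorff_measure_def by (rule SUP_upper) simp
  finally show ?thesis
    using M by (auto intro: less_le_trans[rotated])
qed

lemma hausdorff_dim_points: "ennreal (11/10) \<le> hausdorff_dim (point ` {0..<1})"
  unfolding hausdorff_dim_def
proof (rule INF_greatest)
  fix s assume s: "s \<in> {s. 0 \<le> s \<and> hausdorff_measure s (point ` {0..<1}) = 0}"
  have "\<not> s \<le> 11/10"
    using hausdorff_measure_image_pos[OF dist_le_powr_dist_point, of s] s by auto
  then show "ennreal (11/10) \<le> ennreal s" by (intro ennreal_leI) simp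
qed

theorem mainTheorem1:
  "\<exists>C :: (real ^ 3) set.
     closed C \<and> cone C \<and>
     \<not> (\<exists>P. subspace P \<and> dim P = 2 \<and> P \<subseteq> C) \<and>
     bdim C > 1"
proof (intro exI conjI)
  show "closed dominance_cone" by (rule closed_dominance_cone)
  show "cone dominance_cone" by (rule cone_dominance_cone)
  show "\<not> (\<exists>P. subspace P \<and> dim P = 2 \<and> P \<subseteq> dominance_cone)"
    using no_plane_in_dominance_cone by blast
  have "(1::ennreal) < ennreal (11/10)"
    by (simp flip: ennreal_1 add: ennreal_less_iff)
  also have "\<dots> \<le> hausdorff_dim (point ` {0..<1})"
    by (rule hausdorff_dim_points)
  also have "\<dots> \<le> bdim dominance_cone"
    unfolding bdim_def using diff_set_points by (intro SUP_upper) simp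
  finally show "1 < bdim dominance_cone" .
qed

end
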